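(* Let $G$ be a connected graph of order $n\ge 4$ such that its complement $\overline{G}$ is connected. Then $$2|\mathrm{leaf}(G)|+2|\mathrm{leaf}(\overline{G})|\le \gamma_{tc}(M(G))+\gamma_{tc}(M(\overline{G}))\le \frac{n^2+3n-4}{2}.$$
   Context: All graphs are finite, simple and undirected; $\overline{G}$ is the complement of $G$, and $\mathrm{leaf}(H)=\{v\in V(H)\mid \deg_H(v)=1\}$. For a graph $H$, a set $D\subseteq V(H)$ is a total dominating set if every vertex of $H$ has a neighbor in $D$. A set $D\subseteq V(H)$ is a total outer-connected dominating set of $H$ if $D$ is a total dominating set and the induced subgraph $H[V(H)\setminus D]$ is connected; $\gamma_{tc}(H)$ denotes the minimum cardinality of a total outer-connected dominating set of $H$. The middle graph $M(G)$ of a graph $G$ has vertex set $V(G)\cup E(G)$, where two elements $x,y$ are adjacent iff either $x,y\in E(G)$ are edges of $G$ sharing an endpoint, or one of them is a vertex of $G$ and the other is an edge of $G$ incident to it. *)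

theory Defs
  imports Complex_Main "Graph_Theory.Graph_Theory"
begin

(* A finite simple undirected graph is a pair_graph: a finite loop-free digraph with a
   symmetric arc relation, each undirected edge {u, v} being the pair of arcs (u, v), (v, u). *)

definition graph_complement :: "'a pair_pre_digraph \<Rightarrow> 'a pair_pre_digraph" where
  "graph_complement G = \<lparr> pverts = pverts G,
     parcs = {(u, v). u \<in> pverts G \<and> v \<in> pverts G \<and> u \<noteq> v \<and> (u, v) \<notin> parcs G} \<rparr>"

(* In a symmetric digraph the out-degree of a vertex is its number of neighbours. *)
definition leaf :: "'a pair_pre_digraph \<Rightarrow> 'a set" where
  "leaf H = {v \<in> pverts H. out_degree (with_proj H) v = 1}"

definition undirected_edges :: "'a pair_pre_digraph \<Rightarrow> 'a set set" where
  "undirected_edges G = {{u, v} | u v. (u, v) \<in> parcs G}"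

definition middle_graph :: "'a pair_pre_digraph \<Rightarrow> ('a + 'a set) pair_pre_digraph" where
  "middle_graph G = \<lparr> pverts = pverts G <+> undirected_edges G,
     parcs = {(Inr e, Inr f) | e f. e \<in> undirected_edges G \<and> f \<in> undirected_edges G \<and>
                e \<noteq> f \<and> e \<inter> f \<noteq> {}}
           \<union> {(Inl v, Inr e) | v e. v \<in> pverts G \<and> e \<in> undirected_edges G \<and> v \<in> e}
           \<union> {(Inr e, Inl v) | v e. v \<in> pverts G \<and> e \<in> undirected_edges G \<and> v \<in> e} \<rparr>"

definition total_dominating_set :: "'a pair_pre_digraph \<Rightarrow> 'a set \<Rightarrow> bool" where
  "total_dominating_set H D \<longleftrightarrow>
     D \<subseteq> pverts H \<and> (\<forall>v \<in> pverts H. \<exists>u \<in> D. (v, u) \<in> parcs H)"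

(* Connectedness requires a nonempty vertex set, so D = V(H) does not qualify. *)
definition total_outer_connected_dominating_set :: "'a pair_pre_digraph \<Rightarrow> 'a set \<Rightarrow> bool" where
  "total_outer_connected_dominating_set H D \<longleftrightarrow>
     total_dominating_set H D \<and>
     Digraph_Component.connected (with_proj H \<restriction> (pverts H - D))"

definition gamma_tc :: "'a pair_pre_digraph \<Rightarrow> nat" where
  "gamma_tc H = (LEAST k. \<exists>D. total_outer_connected_dominating_set H D \<and> card D = k)"

lemma pair_graph_complement:
  assumes "pair_graph G" shows "pair_graph (graph_complement G)"
proof -
  interpret pair_graph G by fact
  have "finite (pverts G \<times> pverts G)" using pair_finite_verts by simp
  then have "finite (parcs (graph_complement G))"
    by (rule finite_subset[rotated]) (auto simp: graph_complement_def)
  then show ?thesis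
    using pair_finite_verts arcs_symmetric
    by unfold_locales (auto simp: graph_complement_def symmetric_def sym_def)
qed

lemma pair_graph_middle:
  assumes "pair_graph G" shows "pair_graph (middle_graph G)"
proof -
  interpret pair_graph G by fact
  have "undirected_edges G = (\<lambda>(u, v). {u, v}) ` parcs G"
    by (auto simp: undirected_edges_def)
  then have fin: "finite (undirected_edges G)" using pair_finite_arcs by simp
  then have finV: "finite (pverts (middle_graph G))"
    using pair_finite_verts by (simp add: middle_graph_def)
  then have "finite (pverts (middle_graph G) \<times> pverts (middle_graph G))" by simp
  then have "finite (parcs (middle_graph G))"
    by (rule finite_subset[rotated]) (auto simp: middle_graph_def)
  then show ?thesis
    using finV by unfold_locales (auto simp: middle_graph_def symmetric_def sym_def)
qed

(* The minimum defining gamma_tc (middle_graph G) is attained: V(M(G)) minus any one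
   vertex of G is a total outer-connected dominating set. *)
lemma middle_graph_tocds_ex:
  assumes "pair_graph G" and conn: "Digraph_Component.connected (with_proj G)"
    and card: "card (pverts G) \<ge> 2" and v: "v \<in> pverts G"
  shows "total_outer_connected_dominating_set (middle_graph G) (pverts (middle_graph G) - {Inl v})"
proof -
  interpret pair_graph G by fact
  let ?M = "middle_graph G"
  have nb: "\<exists>y. (x, y) \<in> parcs G" if x: "x \<in> pverts G" for x
  proof -
    obtain z where z: "z \<in> pverts G" "z \<noteq> x"
      using card x by (metis One_nat_def Suc_1 card_le_Suc0_iff_eq not_less_eq_eq pair_finite_verts)
    have "strongly_connected (with_proj G)"
      using symmetric_connected_imp_strongly_connected[OF pair_sym_arcs conn] .
    then have "x \<rightarrow>\<^sup>*\<^bsub>with_proj G\<^esub> z" using x z by (auto simp: strongly_connected_def)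
    then show ?thesis using z(2) by (auto elim: converse_reachable_cases)
  qed
  have "total_dominating_set ?M (pverts ?M - {Inl v})"
    unfolding total_dominating_set_def
  proof (intro conjI ballI)
    fix w assume w: "w \<in> pverts ?M"
    show "\<exists>u\<in>pverts ?M - {Inl v}. (w, u) \<in> parcs ?M"
    proof (cases w)
      case (Inl x)
      then have x: "x \<in> pverts G" using w by (auto simp: middle_graph_def)
      then obtain y where "(x, y) \<in> parcs G" using nb by blast
      then have "{x, y} \<in> undirected_edges G" by (auto simp: undirected_edges_def)
      then show ?thesis using Inl x
        by (intro bexI[of _ "Inr {x, y}"]) (auto simp: middle_graph_def)
    next
      case (Inr e)
      then have e: "e \<in> undirected_edges G" using w by (auto simp: middle_graph_def)
      then obtain x y where xy: "e = {x, y}" "(x, y) \<in> parcs G"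
        by (auto simp: undirected_edges_def)
      then have "x \<noteq> y" "x \<in> pverts G" "y \<in> pverts G"
        using no_loops' wellformed' by auto
      then obtain z where "z \<in> e" "z \<noteq> v" "z \<in> pverts G" using xy by auto
      then show ?thesis using Inr e
        by (intro bexI[of _ "Inl z"]) (auto simp: middle_graph_def)
    qed
  qed auto
  moreover have "pverts ?M - (pverts ?M - {Inl v}) = {Inl v}"
    using v by (auto simp: middle_graph_def)
  moreover have "Digraph_Component.connected (with_proj ?M \<restriction> {Inl v})"
    by (auto simp: Digraph_Component.connected_def strongly_connected_def reachable_def mk_symmetric_def
        intro: rtrancl_on_refl)
  ultimately show ?thesis
    by (simp add: total_outer_connected_dominating_set_def)
qed

end

theory Submission
  imports Defs
begin

text \<open>Upper bound: deleting one vertex of the base graph from a middle graph leaves a total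
outer-connected dominating set, and the edge sets of a graph and its complement partition the
2-element subsets of the vertex set. Lower bound: if \<open>v\<close> is a leaf with edge \<open>e\<close>, then \<open>e\<close> is the
only neighbour of \<open>v\<close> in the middle graph, so \<open>e\<close> lies in every total dominating set \<open>D\<close>; if \<open>v\<close>
is not in \<open>D\<close>, then \<open>v\<close> is isolated outside \<open>D\<close>, hence the only element outside \<open>D\<close>. Leaf edges
are distinct and some vertex is not a leaf, so \<open>D\<close> has at least as many base vertices and at least
as many edges as there are leaves.\<close>

text \<open>Out-degree 1 makes the set of outgoing arcs a singleton, and the head of its only arc is
  the neighbour. This replaces the degree count in \<open>leaf\<close> by a statement about
  adjacency.\<close>

lemma leaf_neighbour:
  assumes "v \<in> leaf G"
  obtains u where "(v, u) \<in> parcs G" "\<And>w. (v, w) \<in> parcs G \<Longrightarrow> w = u"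
proof -
  have "card (out_arcs (with_proj G) v) = 1"
    using assms by (simp add: leaf_def out_degree_def)
  then obtain a where a: "out_arcs (with_proj G) v = {a}"
    by (rule card_1_singletonE)
  then have "a \<in> out_arcs (with_proj G) v" by simp
  then have "(v, snd a) \<in> parcs G" by (cases a) (simp add: out_arcs_def)
  moreover have "w = snd a" if "(v, w) \<in> parcs G" for w
  proof -
    have "(v, w) \<in> out_arcs (with_proj G) v" using that by (simp add: out_arcs_def)
    then show ?thesis using a by auto
  qed
  ultimately show ?thesis by (rule that)
qed

text \<open>Connectedness is strong connectedness of the symmetric closure, hence \<open>iso\<close>
  excludes arcs in both directions. By induction along a walk, whatever is reachable from
  \<open>v\<close> inside \<open>S\<close> is \<open>v\<close> itself.\<close>

lemma isolated_in_connected: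
  assumes conn: "Digraph_Component.connected (with_proj H \<restriction> S)"
    and "v \<in> S"
    and iso: "\<And>w. w \<in> S \<Longrightarrow> (v, w) \<notin> parcs H \<and> (w, v) \<notin> parcs H"
  shows "S = {v}"
proof (rule ccontr)
  assume "S \<noteq> {v}"
  then obtain w where w: "w \<in> S" "w \<noteq> v" using \<open>v \<in> S\<close> by blast
  let ?K = "with_proj (mk_symmetric (with_proj H \<restriction> S))"
  have "v \<rightarrow>\<^sup>*\<^bsub>?K\<^esub> w"
    using conn w \<open>v \<in> S\<close> by (auto simp: Digraph_Component.connected_def strongly_connected_def)
  then have "w = v"
    unfolding reachable_def
  proof (induction rule: rtrancl_on_induct)
    case (step x y)
    then show ?case
      using iso \<open>v \<in> S\<close> by (auto simp: mk_symmetric_def induce_subgraph_def arcs_ends_conv)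
  qed simp
  with w(2) show False ..
qed

context pair_graph
begin

text \<open>Without loops every edge is a genuine 2-subset. This gives finiteness of the edge set
  and, later, the comparison with a binomial coefficient.\<close>

lemma undirected_edges_subset: "undirected_edges G \<subseteq> {e. e \<subseteq> pverts G \<and> card e = 2}"
proof
  fix e assume "e \<in> undirected_edges G"
  then obtain x y where "e = {x, y}" "(x, y) \<in> parcs G"
    by (auto simp: undirected_edges_def)
  moreover from this have "x \<noteq> y" "x \<in> pverts G" "y \<in> pverts G"
    using no_loops' wellformed' by auto
  ultimately show "e \<in> {e. e \<subseteq> pverts G \<and> card e = 2}" by simp
qed

lemma finite_undirected_edges: "finite (undirected_edges G)"
  by (rule finite_subset[OF undirected_edges_subset]) simp

lemma parcs_sym: "(u, v) \<in> parcs G \<Longrightarrow> (v, u) \<in> parcs G"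
  using arcs_symmetric by blast

lemma doubleton_undirected_edge: "{u, v} \<in> undirected_edges G \<longleftrightarrow> (u, v) \<in> parcs G"
  using parcs_sym by (auto simp: undirected_edges_def doubleton_eq_iff)

lemma gamma_tc_middle_graph_le:
  assumes "Digraph_Component.connected (with_proj G)" and "card (pverts G) \<ge> 2"
  shows "gamma_tc (middle_graph G) \<le> card (pverts G) + card (undirected_edges G) - 1"
proof -
  obtain v where v: "v \<in> pverts G" using assms(2) by fastforce
  let ?D = "pverts (middle_graph G) - {Inl v}"
  have "total_outer_connected_dominating_set (middle_graph G) ?D"
    by (rule middle_graph_tocds_ex[OF _ assms v]) unfold_locales
  then have "gamma_tc (middle_graph G) \<le> card ?D"
    unfolding gamma_tc_def by (intro Least_le) blast
  \<comment> \<open>The truncated subtraction is exact here, since \<open>Inl v\<close> is one of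
    the elements counted.\<close>
  also have "card ?D = card (pverts G) + card (undirected_edges G) - 1"
    using v finite_undirected_edges
    by (subst card_Diff_singleton) (auto simp: middle_graph_def card_Plus)
  finally show ?thesis .
qed

text \<open>Two adjacent leaves have no neighbours but each other, so \<open>{u, v}\<close> is
  closed under reachability and a third vertex could not be reached from \<open>u\<close>. This
  later provides a vertex that is not a leaf and shows that distinct leaves have distinct
  edges.\<close>

lemma leaves_not_adjacent:
  assumes conn: "Digraph_Component.connected (with_proj G)" and card: "card (pverts G) \<ge> 3"
    and u: "u \<in> leaf G" and v: "v \<in> leaf G"
  shows "(u, v) \<notin> parcs G"
proof
  assume uv: "(u, v) \<in> parcs G"
  have u1: "w = v" if "(u, w) \<in> parcs G" for w
    using leaf_neighbour[OF u] that uv by metis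
  have v1: "w = u" if "(v, w) \<in> parcs G" for w
    using leaf_neighbour[OF v] that parcs_sym[OF uv] by metis
  have "\<not> pverts G \<subseteq> {u, v}"
  proof
    assume "pverts G \<subseteq> {u, v}"
    then have "card (pverts G) \<le> card {u, v}" by (intro card_mono) auto
    also have "\<dots> \<le> 2" by (simp add: card_insert_if)
    finally show False using card by simp
  qed
  then obtain z where z: "z \<in> pverts G" "z \<notin> {u, v}" by blast
  have "strongly_connected (with_proj G)"
    using symmetric_connected_imp_strongly_connected[OF pair_sym_arcs conn] .
  then have "u \<rightarrow>\<^sup>*\<^bsub>with_proj G\<^esub> z"
    using u z by (auto simp: strongly_connected_def leaf_def)
  then have "z \<in> {u, v}"
  proof (induction rule: reachable_induct)
    case (step x y)
    then show ?case using u1 v1 by auto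
  qed auto
  with z show False by simp
qed

lemma leaf_le_tocds_card:
  assumes conn: "Digraph_Component.connected (with_proj G)" and card: "card (pverts G) \<ge> 3"
    and D: "total_outer_connected_dominating_set (middle_graph G) D"
  shows "2 * card (leaf G) \<le> card D"
proof -
  let ?M = "middle_graph G"
  have tds: "total_dominating_set ?M D"
    and oc: "Digraph_Component.connected (with_proj ?M \<restriction> (pverts ?M - D))"
    using D by (auto simp: total_outer_connected_dominating_set_def)
  have finM: "finite (pverts ?M)"
    using finite_undirected_edges by (simp add: middle_graph_def)
  have DM: "D \<subseteq> pverts ?M" using tds by (simp add: total_dominating_set_def)
  then have finD: "finite D" using finM finite_subset by blast
  have "\<forall>v\<in>leaf G. \<exists>u. (v, u) \<in> parcs G \<and> (\<forall>w. (v, w) \<in> parcs G \<longrightarrow> w = u)"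
    by (meson leaf_neighbour)
  then obtain f where f: "\<And>v. v \<in> leaf G \<Longrightarrow> (v, f v) \<in> parcs G"
    and fu: "\<And>v w. v \<in> leaf G \<Longrightarrow> (v, w) \<in> parcs G \<Longrightarrow> w = f v"
    by metis
  have only_edge: "e = {v, f v}" if v: "v \<in> leaf G" and e: "e \<in> undirected_edges G" "v \<in> e" for v e
  proof -
    from e obtain w where "e = {v, w}" "(v, w) \<in> parcs G"
      using parcs_sym by (auto simp: undirected_edges_def)
    then show ?thesis using fu v by blast
  qed
  have edgeD: "Inr {v, f v} \<in> D" if v: "v \<in> leaf G" for v
  proof -
    have "Inl v \<in> pverts ?M" using v by (auto simp: middle_graph_def leaf_def)
    then obtain x where x: "x \<in> D" "(Inl v, x) \<in> parcs ?M"
      using tds by (auto simp: total_dominating_set_def)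
    then obtain e where "x = Inr e" "e \<in> undirected_edges G" "v \<in> e"
      by (auto simp: middle_graph_def)
    then show ?thesis using only_edge[OF v] x by blast
  qed
  have leafV: "leaf G \<subseteq> pverts G" by (auto simp: leaf_def)
  then have fin_leaf: "finite (leaf G)" using finite_subset by fastforce
  let ?A = "{v \<in> pverts G. Inl v \<in> D}"
  have A: "card (leaf G) \<le> card ?A"
  proof (cases "Inl ` leaf G \<subseteq> D")
    case True
    then show ?thesis using leafV by (intro card_mono) auto
  next
    case False
    then obtain v where v: "v \<in> leaf G" "Inl v \<notin> D" by blast
    have "pverts ?M - D = {Inl v}"
    proof (rule isolated_in_connected[OF oc])
      show "Inl v \<in> pverts ?M - D" using v leafV by (auto simp: middle_graph_def)
    next
      fix w assume "w \<in> pverts ?M - D"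
      then show "(Inl v, w) \<notin> parcs ?M \<and> (w, Inl v) \<notin> parcs ?M"
        using only_edge[OF v(1)] edgeD[OF v(1)] by (auto simp: middle_graph_def)
    qed
    \<comment> \<open>All base vertices except \<open>v\<close> lie in \<open>D\<close>, so
      \<open>?A\<close> has at least n - 1 elements. The neighbour \<open>f v\<close> of
      \<open>v\<close> is no leaf, so there are at most n - 1 leaves.\<close>
    then have "pverts G - {v} \<subseteq> ?A" by (auto simp: middle_graph_def)
    then have "card (pverts G - {v}) \<le> card ?A" by (intro card_mono) auto
    moreover have "f v \<in> pverts G" using f[OF v(1)] wellformed' by auto
    moreover have "f v \<notin> leaf G"
      using leaves_not_adjacent[OF conn card v(1)] f[OF v(1)] by blast
    moreover have "card (leaf G) \<le> card (pverts G - {f v})"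
      using leafV \<open>f v \<notin> leaf G\<close> by (intro card_mono) auto
    ultimately show ?thesis
      using leafV v(1) by (simp add: card_Diff_singleton subset_iff)
  qed
  let ?E = "(\<lambda>v. {v, f v}) ` leaf G"
  \<comment> \<open>If leaves \<open>v\<close> and \<open>w\<close> with \<open>v\<close> \<noteq>
    \<open>w\<close> had the same edge, then \<open>f v = w\<close>, and two leaves would be
    adjacent.\<close>
  have "inj_on (\<lambda>v. {v, f v}) (leaf G)"
    using leaves_not_adjacent[OF conn card] f
    by (intro inj_onI) (metis doubleton_eq_iff)
  then have "card ?E = card (leaf G)" by (rule card_image)
  then have "2 * card (leaf G) \<le> card ?A + card ?E" using A by simp
  \<comment> \<open>The tags \<open>Inl\<close> and \<open>Inr\<close> keep base vertices and edges
    apart, so the two counts add up inside \<open>D\<close>.\<close>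
  also have "\<dots> = card (?A <+> ?E)" using fin_leaf by (simp add: card_Plus)
  also have "\<dots> \<le> card D" using edgeD finD by (intro card_mono) auto
  finally show ?thesis .
qed

lemma leaf_le_gamma_tc_middle_graph:
  assumes conn: "Digraph_Component.connected (with_proj G)" and card: "card (pverts G) \<ge> 3"
  shows "2 * card (leaf G) \<le> gamma_tc (middle_graph G)"
proof -
  let ?P = "\<lambda>k. \<exists>D. total_outer_connected_dominating_set (middle_graph G) D \<and> card D = k"
  obtain v where v: "v \<in> pverts G" using card by fastforce
  \<comment> \<open>A witness is required for \<open>LEAST\<close> to be attained; the bound for an
    arbitrary such set then applies to a minimum one.\<close>
  have "total_outer_connected_dominating_set (middle_graph G) (pverts (middle_graph G) - {Inl v})"
    by (rule middle_graph_tocds_ex[OF _ conn _ v]) (use card in simp_all, unfold_locales)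
  then have "\<exists>k. ?P k" by blast
  then have "?P (gamma_tc (middle_graph G))" unfolding gamma_tc_def by (rule LeastI_ex)
  then show ?thesis using leaf_le_tocds_card[OF assms] by metis
qed

text \<open>No pair is an arc of both \<open>G\<close> and its complement, so the two edge sets are
  disjoint families of 2-subsets of the same vertex set.\<close>

lemma card_undirected_edges_complement:
  "card (undirected_edges G) + card (undirected_edges (graph_complement G))
     \<le> card (pverts G) choose 2"
proof -
  interpret C: pair_graph "graph_complement G"
    by (rule pair_graph_complement) unfold_locales
  have [simp]: "pverts (graph_complement G) = pverts G" by (simp add: graph_complement_def)
  let ?E = "undirected_edges G" and ?F = "undirected_edges (graph_complement G)"
  have "?E \<inter> ?F = {}"
  proof (intro equals0I)
    fix e assume e: "e \<in> ?E \<inter> ?F"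
    then obtain x y where "e = {x, y}" by (auto simp: undirected_edges_def)
    with e show False
      by (auto simp: doubleton_undirected_edge C.doubleton_undirected_edge)
        (auto simp: graph_complement_def)
  qed
  then have "card ?E + card ?F = card (?E \<union> ?F)"
    using finite_undirected_edges C.finite_undirected_edges by (simp add: card_Un_disjoint)
  also have "\<dots> \<le> card {e. e \<subseteq> pverts G \<and> card e = 2}"
    using undirected_edges_subset C.undirected_edges_subset by (intro card_mono) auto
  also have "\<dots> = card (pverts G) choose 2" by (simp add: n_subsets)
  finally show ?thesis .
qed

end

theorem theorem5p2:
  fixes G :: "'a pair_pre_digraph" and n :: nat
  assumes "pair_graph G"
    and "card (pverts G) = n"
    and "n \<ge> 4"
    and "Digraph_Component.connected (with_proj G)"
    and "Digraph_Component.connected (with_proj (graph_complement G))"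
  shows "2 * card (leaf G) + 2 * card (leaf (graph_complement G))
           \<le> gamma_tc (middle_graph G) + gamma_tc (middle_graph (graph_complement G))
       \<and> real (gamma_tc (middle_graph G) + gamma_tc (middle_graph (graph_complement G)))
           \<le> (real n ^ 2 + 3 * real n - 4) / 2"
proof
  interpret pair_graph G by fact
  interpret C: pair_graph "graph_complement G"
    using assms(1) by (rule pair_graph_complement)
  have V: "card (pverts (graph_complement G)) = n"
    using assms(2) by (simp add: graph_complement_def)
  show "2 * card (leaf G) + 2 * card (leaf (graph_complement G))
      \<le> gamma_tc (middle_graph G) + gamma_tc (middle_graph (graph_complement G))"
    using leaf_le_gamma_tc_middle_graph[OF assms(4)] C.leaf_le_gamma_tc_middle_graph[OF assms(5)]
      assms(2,3) V by simp
  let ?e = "card (undirected_edges G)" and ?f = "card (undirected_edges (graph_complement G))"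
  have "gamma_tc (middle_graph G) + gamma_tc (middle_graph (graph_complement G))
      \<le> (n + ?e - 1) + (n + ?f - 1)"
    using gamma_tc_middle_graph_le[OF assms(4)] C.gamma_tc_middle_graph_le[OF assms(5)]
      assms(2,3) V by simp
  \<comment> \<open>The two subtracted ones move to the left as \<open>+ 2\<close>, so that no
    truncated subtraction is left before passing to the reals.\<close>
  then have "gamma_tc (middle_graph G) + gamma_tc (middle_graph (graph_complement G)) + 2
      \<le> 2 * n + (n choose 2)"
    using card_undirected_edges_complement[unfolded assms(2)] assms(3) by linarith
  then have "real (gamma_tc (middle_graph G) + gamma_tc (middle_graph (graph_complement G))) + 2
      \<le> 2 * real n + real (n choose 2)"
    by linarith
  moreover have "real (n choose 2) = real n * (real n - 1) / 2"
    using assms(3) by (simp add: choose_two real_of_nat_div of_nat_diff)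
  \<comment> \<open>Indeed 2n + n(n - 1)/2 - 2 = (n^2 + 3n - 4)/2.\<close>
  ultimately show "real (gamma_tc (middle_graph G) + gamma_tc (middle_graph (graph_complement G)))
      \<le> (real n ^ 2 + 3 * real n - 4) / 2"
    by (simp add: field_simps power2_eq_square)
qed

end
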